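(* Let $\mathbb{F}_q$ be a finite field with $q$ elements, let $k$ and $d$ be integers with $k>d\ge 3$ and $q-1>k+d$, and let $C$ be the standard Reed--Solomon code of dimension $k$ over $\mathbb{F}_q$. Let $\epsilon$ be a real number with $0<\epsilon<1$ and let $\mathbf{w}\in\mathbb{F}_q^{q-1}$ be a word generated by a polynomial $f\in\mathbb{F}_q[T]$ of degree $k+d$. If the conditions $$q>\max\{(k+1)^2,\,14\,d^{2+\epsilon}\},\qquad k\ge d\Big(\frac{2}{\epsilon}+1\Big)$$ hold, then $\mathbf{w}$ is not a deep hole of $C$.
   Context: Write $\mathbb{F}_q^*=\{x_1,\ldots,x_{q-1}\}$ for the set of nonzero elements of $\mathbb{F}_q$. The standard Reed--Solomon code of dimension $k$ over $\mathbb{F}_q$ is $$C=\{(g(x_1),\ldots,g(x_{q-1})) : g\in\mathbb{F}_q[T],\ \deg g\le k-1\}\subset\mathbb{F}_q^{q-1}.$$ The word generated by a polynomial $f\in\mathbb{F}_q[T]$ is $(f(x_1),\ldots,f(x_{q-1}))\in\mathbb{F}_q^{q-1}$. For $\mathbf{w}\in\mathbb{F}_q^{q-1}$, the distance to the code is $\mathsf{d}(\mathbf{w},C)=\min_{\mathbf{c}\in C}\mathsf{d}(\mathbf{w},\mathbf{c})$, where $\mathsf{d}$ is the Hamming distance. The covering radius of $C$ is $\rho=\max_{\mathbf{y}\in\mathbb{F}_q^{q-1}}\mathsf{d}(\mathbf{y},C)$ (it is well known that $\rho=q-1-k$). A word $\mathbf{w}$ is a deep hole of $C$ if $\mathsf{d}(\mathbf{w},C)=\rho$.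 *)

theory Defs
  imports Complex_Main "HOL-Library.Cardinality" "HOL-Computational_Algebra.Polynomial"
begin

text \<open>
  Words of length n over a field are lists of length n. The evaluation points are given
  by a list \<open>xs\<close>; the standard Reed-Solomon code arises when \<open>xs\<close> enumerates the nonzero
  field elements without repetition.
\<close>

definition words :: "nat \<Rightarrow> 'a list set" where
  "words n = {w. length w = n}"

text \<open>Only meaningful for words of equal length.\<close>

definition hamming_dist :: "'a list \<Rightarrow> 'a list \<Rightarrow> nat" where
  "hamming_dist u v = card {i. i < length u \<and> u ! i \<noteq> v ! i}"

definition dist_to_code :: "'a list \<Rightarrow> 'a list set \<Rightarrow> nat" where
  "dist_to_code w C = Min ((\<lambda>c. hamming_dist w c) ` C)"

definition covering_radius :: "nat \<Rightarrow> 'a list set \<Rightarrow> nat" where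
  "covering_radius n C = Max ((\<lambda>y. dist_to_code y C) ` words n)"

definition deep_hole :: "nat \<Rightarrow> 'a list set \<Rightarrow> 'a list \<Rightarrow> bool" where
  "deep_hole n C w \<longleftrightarrow> w \<in> words n \<and> dist_to_code w C = covering_radius n C"

definition generated_word :: "'a::field list \<Rightarrow> 'a poly \<Rightarrow> 'a list" where
  "generated_word xs f = map (poly f) xs"

text \<open>
  The disjunct \<open>g = 0\<close> encodes the convention that the zero polynomial has degree
  minus infinity; it is redundant for positive k.
\<close>

definition reed_solomon_code :: "'a::field list \<Rightarrow> nat \<Rightarrow> 'a list set" where
  "reed_solomon_code xs k = {generated_word xs g | g. g = 0 \<or> degree g < k}"

definition enumerates_nonzero :: "'a::field list \<Rightarrow> bool" where
  "enumerates_nonzero xs \<longleftrightarrow> distinct xs \<and> set xs = UNIV - {0}"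

text \<open>The sets under \<open>Min\<close> and \<open>Max\<close> above are finite and nonempty.\<close>

lemma finite_words: "finite (words n :: 'a::finite list set)"
  using finite_lists_length_eq[of "UNIV :: 'a set" n] by (simp add: words_def)

lemma words_nonempty: "words n \<noteq> {}"
  using Ex_list_of_length[of n] by (auto simp: words_def)

lemma reed_solomon_code_subset: "reed_solomon_code xs k \<subseteq> words (length xs)"
  by (auto simp: reed_solomon_code_def generated_word_def words_def)

lemma finite_reed_solomon_code:
  "finite (reed_solomon_code xs k :: 'a::{field,finite} list set)"
  using reed_solomon_code_subset finite_words by (rule finite_subset)

lemma reed_solomon_code_nonempty: "reed_solomon_code xs k \<noteq> {}"
  by (auto simp: reed_solomon_code_def)

lemma length_enumerates_nonzero:
  fixes xs :: "'a::{field,finite} list"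
  assumes "enumerates_nonzero xs"
  shows "length xs = CARD('a) - 1"
  using assms distinct_card[of xs] by (simp add: enumerates_nonzero_def card_Diff_singleton)

end

theory Submission
  imports Defs "HOL-Computational_Algebra.Primes" "HOL-Library.FuncSet"
begin

text \<open>
  The proof turns deep holes into permutation polynomials. Let
  \<open>f[x\<^sub>1, ..., x\<^sub>k\<^sub>+\<^sub>1]\<close> be the divided difference of \<open>f\<close>. It vanishes for some distinct nonzero nodes exactly
  when some polynomial of degree less than \<open>k\<close> agrees with \<open>f\<close> in \<open>k + 1\<close> evaluation points, that is, when
  the word of \<open>f\<close> is not a deep hole. Since
  \<open>(x - y) * f[S, x, y] = f[S, x] - f[S, y]\<close>, a deep hole has the property that, for each set \<open>S\<close> of
  \<open>k - 1\<close> nonzero nodes, the polynomial \<open>f[S, _]\<close>, of degree \<open>n = d + 1\<close>, is injective outside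
  \<open>S\<close> and \<open>0\<close> (\<open>deep_hole_divided_diff_inj_on\<close>).

  The hypotheses give \<open>k > 3 * d\<close>, and together with \<open>q > (k + 1)\<^sup>2\<close> this makes \<open>n\<close> so small
  that injectivity outside \<open>k\<close> points implies injectivity everywhere
  (\<open>inj_if_inj_outside_small_set\<close>, a comparison of power sums). Because divided differences are
  symmetric in their nodes, nodes can now be exchanged with arguments, and it follows that
  \<open>f[S, _]\<close> permutes the field for every multiset \<open>S\<close> of \<open>k - 1\<close> field elements, with repetitions and \<open>0\<close> allowed
  (\<open>inj_divided_diff_all_multisets\<close>).

  This is impossible (\<open>ex_divided_diff_not_inj\<close>). As in Hermite's criterion, the sum over \<open>x\<close> of
  \<open>f[S, x] ^ M\<close> does not depend on \<open>S\<close>, for any \<open>M\<close>. As a polynomial in \<open>x\<close> and the nodes, \<open>f[S, x]\<close> has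
  as its leading form a multiple of the complete homogeneous symmetric polynomial of degree \<open>n\<close>, all of
  whose coefficients are \<open>1\<close>. With \<open>q = p ^ e\<close>, choose \<open>j\<close> as \<open>(p - 1) / n\<close> rounded up,
  \<open>r = n * j - (p - 1)\<close> and \<open>M = j * (1 + p + ... + p ^ (e - 1))\<close>. Looking at one base-\<open>p\<close> digit at a time, the
  coefficient in \<open>f[S, x] ^ M\<close> of \<open>x ^ (q - 1)\<close> times the product of the \<open>M / j\<close>-th powers of \<open>r\<close> of the
  nodes turns out to be a nonzero multiple of \<open>j ^ (e * r)\<close>, which is nonzero because \<open>0 < j < p\<close>
  (\<open>twisted_power_sum\<close>). Summation over \<open>x\<close> and these nodes, with suitable weights, detects this
  coefficient. For \<open>r > 0\<close> this contradicts the independence of \<open>S\<close>; for \<open>r = 0\<close> it contradicts that the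
  sum over \<open>x\<close> is the sum of all \<open>M\<close>-th powers in the field, which is \<open>0\<close> since \<open>M < q - 1\<close>.
\<close>

section \<open>Power sums over finite fields\<close>

lemma prime_CHAR_finite_field: "prime CHAR('a::{field,finite})"
  using finite_imp_CHAR_pos[where 'a='a] prime_CHAR_semidom[where 'a='a] by simp

lemma sum_poly_eq_0:
  fixes p :: "'a::{field,finite} poly"
  assumes "\<And>i. i \<le> degree p \<Longrightarrow> (\<Sum>x\<in>(UNIV::'a set). x ^ i) = 0"
  shows "(\<Sum>x\<in>UNIV. poly p x) = 0"
proof -
  have "(\<Sum>x\<in>UNIV. poly p x) = (\<Sum>i\<le>degree p. coeff p i * (\<Sum>x\<in>UNIV. x ^ i))"
    unfolding poly_altdef sum_distrib_left by (rule sum.swap)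
  also have "\<dots> = 0" using assms by simp
  finally show ?thesis .
qed

lemma power_card_minus_1:
  fixes x :: "'a::{field,finite}"
  assumes "x \<noteq> 0"
  shows "x ^ (CARD('a) - 1) = 1"
proof -
  have "\<Prod>(UNIV-{0}) = (\<Prod>y\<in>UNIV-{0}. x * y)"
    by (rule prod.reindex_bij_witness[of _ "\<lambda>y. x * y" "\<lambda>y. y / x"]) (use assms in auto)
  also have "\<dots> = x ^ (CARD('a) - 1) * \<Prod>(UNIV-{0})"
    by (simp add: prod.distrib card_Diff_singleton)
  finally show ?thesis by simp
qed

lemma sum_power_finite_field:
  "(\<Sum>x\<in>(UNIV::'a::{field,finite} set). x ^ m) =
    (if m > 0 \<and> (CARD('a) - 1) dvd m then -1 else 0)"
proof -
  have card_zero: "of_nat CARD('a) = (0::'a)"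
  proof -
    have "(\<Sum>x\<in>(UNIV::'a set). x) = (\<Sum>x\<in>UNIV. x + 1)"
      by (rule sum.reindex_bij_witness[of _ "\<lambda>x. x + 1" "\<lambda>x. x - 1"]) auto
    thus ?thesis by (simp add: sum.distrib)
  qed
  have two: "CARD('a) \<ge> 2"
    using card_mono[of UNIV "{0, 1::'a}"] by simp
  consider "m = 0" | "m > 0" "(CARD('a) - 1) dvd m" | "\<not> (CARD('a) - 1) dvd m" by blast
  thus ?thesis
  proof cases
    case 1
    thus ?thesis using card_zero by simp
  next
    case 2
    then obtain j where j: "m = (CARD('a) - 1) * j" by auto
    have "(\<Sum>x\<in>(UNIV::'a set). x ^ m) = (\<Sum>x\<in>UNIV-{0}. x ^ m)"
      using 2 by (intro sum.mono_neutral_right) auto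
    also have "\<dots> = (\<Sum>x\<in>UNIV-{0::'a}. 1)"
      by (intro sum.cong refl) (simp add: j power_mult power_card_minus_1 del: One_nat_def)
    also have "\<dots> = -1"
      using card_zero two by (simp add: card_Diff_singleton of_nat_diff)
    finally show ?thesis using 2 by simp
  next
    case 3
    define r where "r = m mod (CARD('a) - 1)"
    have r: "0 < r" "r < CARD('a) - 1"
      using 3 two by (auto simp: r_def dvd_eq_mod_eq_0)
    have pw: "x ^ m = x ^ r" if "x \<noteq> 0" for x :: 'a
    proof -
      have "x ^ m = x ^ ((CARD('a) - 1) * (m div (CARD('a) - 1)) + r)"
        by (simp add: r_def)
      also have "\<dots> = x ^ r"
        using that by (simp add: power_add power_mult power_card_minus_1 del: One_nat_def)
      finally show ?thesis .
    qed
    have "\<exists>g::'a. g \<noteq> 0 \<and> g ^ r \<noteq> 1"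
    proof (rule ccontr)
      assume "\<not> ?thesis"
      hence sub: "UNIV - {0} \<subseteq> {x::'a. poly (monom 1 r - 1) x = 0}"
        by (auto simp: poly_monom)
      have dg: "degree (monom 1 r - 1 :: 'a poly) = r"
        using r degree_add_eq_left[of "-1" "monom (1::'a) r"] by (simp add: degree_monom_eq)
      have nz: "monom 1 r - 1 \<noteq> (0::'a poly)"
        using dg r by force
      have "CARD('a) - 1 = card (UNIV - {0::'a})" by (simp add: card_Diff_singleton)
      also have "\<dots> \<le> card {x::'a. poly (monom 1 r - 1) x = 0}"
        using sub by (intro card_mono) auto
      also have "\<dots> \<le> r"
        using card_poly_roots_bound[OF nz] dg by simp
      finally show False using r by simp
    qed
    then obtain g :: 'a where g: "g \<noteq> 0" "g ^ r \<noteq> 1" by blast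
    have "(\<Sum>x\<in>UNIV. x ^ m) = (\<Sum>x\<in>UNIV. (g * x) ^ m)"
      by (rule sum.reindex_bij_witness[of _ "\<lambda>x. g * x" "\<lambda>x. x / g"]) (use g in auto)
    also have "\<dots> = g ^ m * (\<Sum>x\<in>UNIV. x ^ m)"
      by (simp add: power_mult_distrib sum_distrib_left)
    finally have "(g ^ m - 1) * (\<Sum>x\<in>UNIV. x ^ m) = 0"
      by (simp add: algebra_simps)
    thus ?thesis using 3 g pw[of g] by simp
  qed
qed

text \<open>
  Write the cardinality \<open>q\<close> as \<open>p ^ e * m\<close> with \<open>p\<close> not dividing \<open>m\<close>. The map \<open>x \<mapsto> x ^ (p ^ e)\<close> is
  additive and injective, hence surjective, so the identity \<open>(x + 1) ^ q = x ^ q + 1\<close> between functions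
  turns into \<open>(y + 1) ^ m = y ^ m + 1\<close> for all \<open>y\<close>. For \<open>m > 1\<close> the difference of the two sides has
  degree less than \<open>m \<le> q\<close>, so this is an identity of polynomials; comparing derivatives at \<open>0\<close> gives
  \<open>m = 0\<close> in the field, a contradiction.
\<close>

lemma card_finite_field_prime_power:
  "\<exists>e. CARD('a::{field,finite}) = CHAR('a) ^ e"
proof -
  define p where "p = CHAR('a)"
  have p: "prime p" unfolding p_def by (rule prime_CHAR_finite_field)
  obtain e m where em: "CARD('a) = p ^ e * m" "\<not> p dvd m"
    using multiplicity_decompose'[of "CARD('a)" p] p
    by (metis finite_UNIV_card_ge_0 not_gr_zero not_prime_unit finite)
  have fd: "(x + y) ^ (p ^ e) = x ^ (p ^ e) + y ^ (p ^ e)" for x y :: 'a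
    using freshmans_dream'[of "p ^ e" e x y] p unfolding p_def by simp
  have "inj (\<lambda>x::'a. x ^ (p ^ e))"
  proof (rule injI)
    fix x y :: 'a assume "x ^ p ^ e = y ^ p ^ e"
    hence "(x - y) ^ p ^ e = 0" using fd[of "x - y" y] by simp
    thus "x = y" by simp
  qed
  hence surj: "surj (\<lambda>x::'a. x ^ (p ^ e))"
    by (simp add: finite_UNIV_inj_surj)
  have root: "(y + 1) ^ m = y ^ m + 1" for y :: 'a
  proof -
    obtain x where x: "y = x ^ p ^ e" using surj by (metis surjD)
    have pw: "z ^ (p ^ e * m) = z" for z :: 'a
    proof (cases "z = 0")
      case True
      thus ?thesis using em(1)[symmetric] by (simp add: finite_UNIV_card_ge_0)
    next
      case False
      have "z ^ CARD('a) = z * z ^ (CARD('a) - 1)"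
        by (subst power_Suc[symmetric]) (simp add: finite_UNIV_card_ge_0)
      thus ?thesis using em(1) power_card_minus_1[OF False] by simp
    qed
    have "(y + 1) ^ m = ((x + 1) ^ p ^ e) ^ m" using fd[of x 1] x by simp
    also have "\<dots> = x + 1" using pw by (simp add: power_mult)
    also have "\<dots> = y ^ m + 1" using pw x by (simp add: power_mult)
    finally show ?thesis .
  qed
  have "m = 1"
  proof (rule ccontr)
    assume "m \<noteq> 1"
    hence m: "m > 1" using em(2) by (cases m) auto
    have "[:1, 1:] ^ m = monom 1 m + (1 :: 'a poly)"
    proof (rule ccontr)
      assume ne: "[:1, 1:] ^ m \<noteq> monom 1 m + (1 :: 'a poly)"
      let ?D = "[:1, 1:] ^ m - (monom 1 m + (1 :: 'a poly))"
      have dg: "degree ?D \<le> m"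
        by (intro degree_diff_le degree_add_le) (auto simp: degree_monom_le degree_linear_power)
      have "coeff ?D m = 0" using m
        by (simp add: coeff_linear_power)
      hence "degree ?D < m" using dg ne m
        by (metis (no_types, lifting) diff_eq_diff_eq leading_coeff_0_iff le_neq_implies_less right_minus_eq)
      moreover have "CARD('a) \<le> degree ?D"
        using card_poly_roots_bound[of ?D] ne root by (simp add: poly_monom add.commute)
      moreover have "m \<le> CARD('a)" using em(1) p
        using prime_gt_0_nat[OF p] by simp
      ultimately show False by simp
    qed
    hence "poly (pderiv ([:1, 1:] ^ m)) 0 = poly (pderiv (monom 1 m + (1 :: 'a poly))) 0"
      by simp
    hence "of_nat m = (0::'a)" using m
      by (simp add: pderiv_power pderiv_add pderiv_monom poly_monom pderiv_pCons power_0_left)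
    thus False using em(2) by (simp add: of_nat_eq_0_iff_char_dvd p_def)
  qed
  thus ?thesis using em unfolding p_def by auto
qed

section \<open>Nearly injective polynomials of small degree\<close>

text \<open>
  A polynomial of small degree that is injective up to a few points is a permutation polynomial.
  Suppose the value \<open>v\<close> is missed. The polynomial \<open>L\<close> in the proof vanishes at every value taken on the
  exceptional set \<open>U\<close> and at every other value missed outside \<open>U\<close>, but not at \<open>v\<close>. Summing \<open>L\<close>
  composed with \<open>g\<close> over the field gives \<open>0\<close>, since its degree is below \<open>q - 1\<close>. On the other hand
  that sum is the sum of \<open>L\<close> over the whole field, which is again \<open>0\<close>, minus the single term \<open>L(v)\<close>.
\<close>

lemma inj_if_inj_outside_small_set:
  fixes g :: "'a::{field,finite} poly"
  assumes inj: "inj_on (poly g) (-U)" and k: "card U \<le> k"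
    and deg: "degree g > 0" "(2 * k - 1) * degree g < CARD('a) - 1"
  shows "inj (poly g)"
proof -
  have "surj (poly g)"
  proof (rule ccontr)
    assume "\<not> surj (poly g)"
    then obtain v where v: "v \<notin> range (poly g)" by auto
    define V where "V = - (poly g ` (-U))"
    define W where "W = (poly g ` U \<union> V) - {v}"
    define L where "L = (\<Prod>w\<in>W. [:-w, 1:])"
    have "card V = card U"
    proof -
      have compl: "card (- X) = CARD('a) - card X" for X :: "'a set"
        by (simp add: Compl_eq_Diff_UNIV card_Diff_subset)
      have "card U \<le> CARD('a)" by (intro card_mono) auto
      thus ?thesis unfolding V_def using inj by (simp add: compl card_image)
    qed
    moreover have "v \<in> V" using v by (auto simp: V_def)
    ultimately have cW: "card W \<le> 2 * k - 1"
      unfolding W_def using k card_Un_le[of "poly g ` U" V] card_image_le[of U "poly g"]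
      by (simp add: card_Diff_singleton)
    have root: "poly L y = 0 \<longleftrightarrow> y \<in> W" for y
      by (auto simp: L_def poly_prod)
    have degL: "degree L = card W"
      by (simp add: L_def degree_prod_eq_sum_degree)
    have "card W * degree g < CARD('a) - 1"
      using mult_le_mono1[OF cW, of "degree g"] deg(2) by linarith
    hence lt1: "degree (pcompose L g) < CARD('a) - 1"
      by (simp add: degree_pcompose degL)
    have "card W \<le> card W * degree g" using deg(1) by simp
    hence lt2: "degree L < CARD('a) - 1"
      using \<open>card W * degree g < CARD('a) - 1\<close> degL by linarith
    have "0 = (\<Sum>x\<in>UNIV. poly (pcompose L g) x)"
      using lt1 by (intro sum_poly_eq_0[symmetric]) (auto simp: sum_power_finite_field dest: dvd_imp_le)
    also have "\<dots> = (\<Sum>x\<in>-U. poly L (poly g x))"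
    proof (subst poly_pcompose, rule sum.mono_neutral_right)
      show "\<forall>i\<in>UNIV - - U. poly L (poly g i) = 0"
        using v by (auto simp: root W_def)
    qed auto
    also have "\<dots> = (\<Sum>y\<in>-V. poly L y)"
      unfolding V_def by (simp add: sum.reindex[OF inj] o_def)
    also have "\<dots> = (\<Sum>y\<in>insert v (-V). poly L y) - poly L v"
      using \<open>v \<in> V\<close> by simp
    also have "(\<Sum>y\<in>insert v (-V). poly L y) = (\<Sum>y\<in>UNIV. poly L y)"
      by (rule sum.mono_neutral_left) (auto simp: root W_def)
    also have "(\<Sum>y\<in>UNIV. poly L y) = 0"
      using lt2 by (intro sum_poly_eq_0) (auto simp: sum_power_finite_field dest: dvd_imp_le)
    finally have "poly L v = 0" by simp
    thus False by (simp add: root W_def)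
  qed
  thus ?thesis by (simp add: finite_UNIV_surj_inj)
qed

section \<open>Divided differences\<close>

text \<open>
  If the nodes in \<open>S\<close> are distinct and \<open>x\<close> is none of them, the value of this polynomial at \<open>x\<close> is
  Newton's divided difference \<open>f[S, x]\<close>. Defining it as a quotient makes repeated nodes harmless and
  the symmetry in the elements of \<open>S\<close> immediate.
\<close>

definition divided_diff :: "'a::field poly \<Rightarrow> 'a multiset \<Rightarrow> 'a poly" where
  "divided_diff f S = f div (\<Prod>a\<in>#S. [:-a, 1:])"

lemma synthetic_div_eq_div: "synthetic_div p (a::'a::field) = p div [:-a, 1:]"
proof -
  have "p div [:-a, 1:] = ([:-a, 1:] * synthetic_div p a + [:poly p a:]) div [:-a, 1:]"
    by (simp only: synthetic_div_correct')
  also have "\<dots> = synthetic_div p a"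
    by (subst poly_div_add_left, subst nonzero_mult_div_cancel_left) (simp_all add: div_poly_less)
  finally show ?thesis ..
qed

lemma divided_diff_empty [simp]: "divided_diff f {#} = f"
  by (simp add: divided_diff_def)

lemma divided_diff_union: "divided_diff f (S + S') = divided_diff (divided_diff f S) S'"
  by (simp add: divided_diff_def poly_div_mult_right)

lemma divided_diff_add_mset:
  "divided_diff f (add_mset a S) = synthetic_div (divided_diff f S) a"
  using divided_diff_union[of f S "{#a#}"] by (simp add: divided_diff_def synthetic_div_eq_div)

lemma degree_divided_diff: "degree (divided_diff f S) = degree f - size S"
  by (induction S) (simp_all add: divided_diff_add_mset degree_synthetic_div)

lemma poly_synthetic_div:
  fixes p :: "'a::field poly"
  shows "(y - x) * poly (synthetic_div p x) y = poly p y - poly p x"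
proof -
  have "poly p y = poly ([:-x, 1:] * synthetic_div p x + [:poly p x:]) y"
    by (simp only: synthetic_div_correct')
  thus ?thesis by (simp add: algebra_simps)
qed

text \<open>
  A collision of \<open>f[S, _]\<close> at two distinct points is a zero of the divided difference on one more
  node. As the nodes form a multiset, \<open>x\<close> then plays the same role as the members of \<open>S\<close>, and any of
  them can be exchanged for \<open>x\<close>.
\<close>

lemma divided_diff_eq_iff:
  assumes "x \<noteq> y"
  shows "poly (divided_diff f S) x = poly (divided_diff f S) y
    \<longleftrightarrow> poly (divided_diff f (add_mset x S)) y = 0"
  using poly_synthetic_div[of y x "divided_diff f S"] assms
  by (auto simp: divided_diff_add_mset)

section \<open>Freeing the nodes\<close>

text \<open>
  The passage from sets of nonzero nodes to all multisets: the nodes are replaced one at a time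
  by arbitrary field elements. Here \<open>B\<close> holds the nodes already freed and \<open>A\<close> the remaining distinct
  nonzero ones. If \<open>f[b, B, A, x] = f[b, B, A, y]\<close> with \<open>x \<noteq> y\<close>, the divided difference on the nodes
  \<open>b, B, A, x, y\<close> vanishes; if moreover \<open>x\<close> avoids \<open>A\<close> and \<open>0\<close>, then reading \<open>x\<close> as a further member
  of \<open>A\<close> shows that \<open>f[B, A, x, _]\<close> takes the same value at \<open>b\<close> and \<open>y\<close>, against the induction
  hypothesis. So injectivity can fail only on a small set, and then it does not fail at all.
\<close>

lemma inj_divided_diff_all_multisets:
  fixes f :: "'a::{field,finite} poly"
  assumes sets: "\<And>A. 0 \<notin> A \<Longrightarrow> card A = m \<Longrightarrow>
      inj_on (poly (divided_diff f (mset_set A))) (- insert 0 A)"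
    and deg: "degree f > m" "(2 * m + 1) * (degree f - m) < CARD('a) - 1"
    and S: "size S = m"
  shows "inj (poly (divided_diff f S))"
proof -
  have ext: "inj (poly (divided_diff f S))"
    if "size S = m" "inj_on (poly (divided_diff f S)) (-U)" "card U \<le> m + 1" for S U
    using inj_if_inj_outside_small_set[OF that(2,3)] deg that(1)
    by (simp add: degree_divided_diff)
  have "inj (poly (divided_diff f (B + mset_set A)))"
    if "0 \<notin> A" "size B + card A = m" for A B
    using that
  proof (induction B arbitrary: A)
    case empty
    hence "card (insert 0 A) \<le> m + 1" by simp
    thus ?case using empty ext[of "mset_set A" "insert 0 A"] sets[of A] by simp
  next
    case (add b B)
    let ?U = "insert b (insert 0 A)"
    show ?case
    proof (rule ext)
      show "size (add_mset b B + mset_set A) = m" using add.prems by simp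
      have "card ?U \<le> Suc (Suc (card A))"
        by (auto simp: card_insert_if)
      thus "card ?U \<le> m + 1" using add.prems by simp
      show "inj_on (poly (divided_diff f (add_mset b B + mset_set A))) (-?U)"
      proof (rule inj_onI, rule ccontr)
        fix x y assume x: "x \<in> -?U" and y: "y \<in> -?U" and ne: "x \<noteq> y"
          and eq: "poly (divided_diff f (add_mset b B + mset_set A)) x
                 = poly (divided_diff f (add_mset b B + mset_set A)) y"
        let ?S = "B + mset_set (insert x A)"
        have "0 = poly (divided_diff f (add_mset x (add_mset b B + mset_set A))) y"
          using eq ne by (simp add: divided_diff_eq_iff)
        also have "add_mset x (add_mset b B + mset_set A) = add_mset b ?S"
          using x by simp
        finally have "poly (divided_diff f ?S) b = poly (divided_diff f ?S) y"
          using y by (subst divided_diff_eq_iff) auto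
        moreover have "inj (poly (divided_diff f ?S))"
          using add.prems x by (intro add.IH) auto
        ultimately have "b = y" by (rule injD[rotated])
        thus False using y by auto
      qed
    qed
  qed
  from this[of "{}" S] S show ?thesis by simp
qed

section \<open>Divided differences as polynomials in the nodes\<close>

lemma sum_PiE_insert:
  assumes "x \<notin> A"
  shows "(\<Sum>g\<in>PiE (insert x A) B. h g) = (\<Sum>y\<in>B x. \<Sum>g\<in>PiE A B. h (g(x := y)))"
  unfolding PiE_insert_eq
  by (subst sum.reindex[OF inj_combinator[OF assms]]) (simp add: sum.cartesian_product case_prod_unfold)

lemma poly_eq_sum_le:
  fixes p :: "'a::field poly"
  shows "degree p \<le> N \<Longrightarrow> poly p c = (\<Sum>a\<le>N. coeff p a * c ^ a)"
  unfolding poly_altdef by (rule sum.mono_neutral_left) (auto simp: coeff_eq_0)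

lemma coeff_synthetic_div:
  fixes p :: "'a::field poly"
  shows "degree p \<le> N \<Longrightarrow> coeff (synthetic_div p c) i = (\<Sum>a\<le>N. coeff p (i + 1 + a) * c ^ a)"
proof (induction p arbitrary: i)
  case (pCons a p)
  hence "degree p \<le> N" by (auto split: if_splits)
  with pCons.IH show ?case
    by (cases i) (auto simp: poly_eq_sum_le)
qed simp

text \<open>
  The coefficients of \<open>f[S, _]\<close> are combinations of complete homogeneous symmetric polynomials in
  the nodes. All exponent vectors in the box \<open>{..N} ^ I\<close> may be summed over, because the coefficient of
  \<open>f\<close> vanishes as soon as the total degree is too large; this avoids side conditions on the
  exponents.
\<close>

lemma coeff_divided_diff:
  fixes f :: "'a::field poly"
  assumes "finite I" "degree f \<le> N"
  shows "coeff (divided_diff f (image_mset v (mset_set I))) m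
    = (\<Sum>\<alpha>\<in>PiE I (\<lambda>_. {..N}). coeff f (m + card I + (\<Sum>i\<in>I. \<alpha> i)) * (\<Prod>i\<in>I. v i ^ \<alpha> i))"
  using assms(1)
proof (induction I arbitrary: m rule: finite_induct)
  case (insert x I)
  let ?g = "divided_diff f (image_mset v (mset_set I))"
  have "degree ?g \<le> N" using assms(2) by (simp add: degree_divided_diff)
  hence "coeff (synthetic_div ?g (v x)) m = (\<Sum>a\<le>N. coeff ?g (m + 1 + a) * v x ^ a)"
    by (rule coeff_synthetic_div)
  also have "\<dots> = (\<Sum>a\<le>N. \<Sum>\<alpha>\<in>PiE I (\<lambda>_. {..N}).
      coeff f (m + card (insert x I) + (\<Sum>i\<in>insert x I. (\<alpha>(x := a)) i))
        * (\<Prod>i\<in>insert x I. v i ^ (\<alpha>(x := a)) i))"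
  proof (rule sum.cong[OF refl], subst insert.IH, subst sum_distrib_right, rule sum.cong[OF refl], goal_cases)
    case (1 a \<alpha>)
    have "(\<Sum>i\<in>I. (\<alpha>(x := a)) i) = (\<Sum>i\<in>I. \<alpha> i)"
      "(\<Prod>i\<in>I. v i ^ (\<alpha>(x := a)) i) = (\<Prod>i\<in>I. v i ^ \<alpha> i)"
      using insert.hyps by (auto intro!: sum.cong prod.cong)
    thus ?case using insert.hyps by (simp add: algebra_simps)
  qed
  also have "\<dots> = (\<Sum>\<alpha>\<in>PiE (insert x I) (\<lambda>_. {..N}).
      coeff f (m + card (insert x I) + (\<Sum>i\<in>insert x I. \<alpha> i)) * (\<Prod>i\<in>insert x I. v i ^ \<alpha> i))"
    using insert.hyps by (subst sum_PiE_insert) auto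
  finally show ?case using insert.hyps by (simp add: divided_diff_add_mset)
qed simp

lemma poly_divided_diff:
  fixes f :: "'a::field poly"
  assumes "finite I" "degree f \<le> N" "x \<notin> I"
  shows "poly (divided_diff f (image_mset v (mset_set I))) (v x)
    = (\<Sum>\<alpha>\<in>PiE (insert x I) (\<lambda>_. {..N}).
        coeff f (card I + (\<Sum>i\<in>insert x I. \<alpha> i)) * (\<Prod>i\<in>insert x I. v i ^ \<alpha> i))"
proof -
  let ?g = "divided_diff f (image_mset v (mset_set I))"
  have "degree ?g \<le> N" using assms(2) by (simp add: degree_divided_diff)
  hence "poly ?g (v x) = (\<Sum>a\<le>N. coeff ?g a * v x ^ a)" by (rule poly_eq_sum_le)
  also have "\<dots> = (\<Sum>a\<le>N. \<Sum>\<alpha>\<in>PiE I (\<lambda>_. {..N}).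
      coeff f (card I + (\<Sum>i\<in>insert x I. (\<alpha>(x := a)) i))
        * (\<Prod>i\<in>insert x I. v i ^ (\<alpha>(x := a)) i))"
  proof (rule sum.cong[OF refl], subst coeff_divided_diff[OF assms(1,2)], subst sum_distrib_right,
      rule sum.cong[OF refl], goal_cases)
    case (1 a \<alpha>)
    have "(\<Sum>i\<in>I. (\<alpha>(x := a)) i) = (\<Sum>i\<in>I. \<alpha> i)"
      "(\<Prod>i\<in>I. v i ^ (\<alpha>(x := a)) i) = (\<Prod>i\<in>I. v i ^ \<alpha> i)"
      using assms(3) by (auto intro!: sum.cong prod.cong)
    thus ?case using assms by (simp add: algebra_simps)
  qed
  also have "\<dots> = (\<Sum>\<alpha>\<in>PiE (insert x I) (\<lambda>_. {..N}).
      coeff f (card I + (\<Sum>i\<in>insert x I. \<alpha> i)) * (\<Prod>i\<in>insert x I. v i ^ \<alpha> i))"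
    using assms by (subst sum_PiE_insert) auto
  finally show ?thesis .
qed

section \<open>Digits and exponent arrays\<close>

text \<open>
  Base-\<open>p\<close> expansions without a bound on the \<open>B t i\<close>: the lowest digit forces \<open>\<mu> i \<le> B 0 i\<close>, and the
  bound on the total over \<open>J\<close> leaves no room for a carry, so equality holds and the argument can be
  repeated with the next digit.
\<close>

lemma digits_unique:
  fixes B :: "nat \<Rightarrow> 'i \<Rightarrow> nat"
  assumes "finite J" "\<And>i. i \<in> J \<Longrightarrow> \<mu> i < p"
    and "\<And>i. i \<in> J \<Longrightarrow> (\<Sum>t<e. p ^ t * B t i) = (\<Sum>t<e. p ^ t * \<mu> i)"
    and "\<And>t. t < e \<Longrightarrow> (\<Sum>i\<in>J. B t i) \<le> (\<Sum>i\<in>J. \<mu> i)"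
    and "t < e" "i \<in> J"
  shows "B t i = \<mu> i"
  using assms(3-)
proof (induction e arbitrary: B t i)
  case (Suc e)
  have split: "B 0 i + p * (\<Sum>t<e. p ^ t * B (Suc t) i) = \<mu> i + p * (\<Sum>t<e. p ^ t * \<mu> i)"
    if "i \<in> J" for i
    using Suc.prems(1)[OF that]
    by (simp only: sum.lessThan_Suc_shift sum_distrib_left) (simp add: mult.assoc)
  have ge: "\<mu> i \<le> B 0 i" if "i \<in> J" for i
  proof -
    have "B 0 i mod p = \<mu> i"
      using arg_cong[OF split[OF that], of "\<lambda>x. x mod p"] assms(2)[OF that] by simp
    thus ?thesis using mod_less_eq_dividend[of "B 0 i" p] by simp
  qed
  have "(\<Sum>i\<in>J. \<mu> i) = (\<Sum>i\<in>J. B 0 i)"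
    using Suc.prems(2)[of 0] sum_mono[of J \<mu> "B 0"] ge by fastforce
  hence zero: "B 0 i = \<mu> i" if "i \<in> J" for i
    using sum_mono_inv[of \<mu> J "B 0" i] ge assms(1) that by auto
  show ?case
  proof (cases t)
    case 0
    thus ?thesis using zero Suc.prems by simp
  next
    case (Suc s)
    have "B (Suc s) i = \<mu> i"
    proof (rule Suc.IH[of "\<lambda>t. B (Suc t)"])
      show "(\<Sum>t<e. p ^ t * B (Suc t) i) = (\<Sum>t<e. p ^ t * \<mu> i)" if "i \<in> J" for i
        using split[OF that] zero[OF that] assms(2)[OF that] by simp
    qed (use Suc Suc.prems in auto)
    thus ?thesis using Suc by simp
  qed
qed simp

text \<open>
  Entry \<open>A (t, u)\<close> is the exponent vector, in the variables \<open>0, ..., r\<close>, of the monomial chosen from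
  the factor number \<open>(t, u)\<close> of \<open>\<psi> ^ (j * (1 + p + ... + p ^ (e - 1)))\<close>, where that factor is the
  \<open>p ^ t\<close>-th power of a polynomial \<open>\<psi>\<close> of degree \<open>n\<close>. The arrays collected here are those with all entries
  of full degree \<open>n\<close> for which, at each digit position \<open>t\<close>, the product over \<open>u\<close> is the monomial with exponent \<open>p - 1\<close> in variable \<open>0\<close> and
  \<open>1\<close> in each of the variables \<open>1, ..., r\<close>.
\<close>

definition digit_arrays :: "nat \<Rightarrow> nat \<Rightarrow> nat \<Rightarrow> nat \<Rightarrow> nat \<Rightarrow> nat \<Rightarrow> (nat \<times> nat \<Rightarrow> nat \<Rightarrow> nat) set" where
  "digit_arrays e j r n p N =
    {A \<in> PiE ({..<e} \<times> {..<j}) (\<lambda>_. PiE {0..r} (\<lambda>_. {..N})).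
      (\<forall>\<tau>\<in>{..<e} \<times> {..<j}. (\<Sum>i=0..r. A \<tau> i) = n) \<and>
      (\<forall>t<e. \<forall>i\<in>{0..r}. (\<Sum>u<j. A (t, u) i) = (if i = 0 then p - 1 else 1))}"

lemma sum_eq_1_unique:
  fixes g :: "nat \<Rightarrow> nat"
  assumes "(\<Sum>u<j. g u) = 1"
  shows "\<exists>w<j. \<forall>u<j. g u = of_bool (w = u)"
proof -
  obtain w where w: "w < j" "g w = 1" "\<forall>b\<in>{..<j}. w \<noteq> b \<longrightarrow> g b = 0"
    using assms sum_eq_1_iff[of "{..<j}" g] by auto
  thus ?thesis by (intro exI[of _ w]) auto
qed

text \<open>
  For each digit position, every one of the variables \<open>1, ..., r\<close> has to be assigned to one of the \<open>j\<close>
  factors; the exponent of variable \<open>0\<close> then fills each factor up to degree \<open>n\<close>, which is possible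
  since \<open>r \<le> n\<close>. These \<open>e * r\<close> free choices are the function \<open>\<phi>\<close> in the proof.
\<close>

lemma card_digit_arrays:
  assumes "n * j = r + (p - 1)" "r \<le> n" "n \<le> N" "0 < N"
  shows "card (digit_arrays e j r n p N) = j ^ (e * r)"
proof -
  define D where "D = PiE ({..<e} \<times> {1..r}) (\<lambda>_. {..<j})"
  define \<Phi> where "\<Phi> \<phi> = (\<lambda>\<tau>\<in>{..<e} \<times> {..<j}. \<lambda>i\<in>{0..r}.
      if i = 0 then n - card {i\<in>{1..r}. \<phi> (fst \<tau>, i) = snd \<tau>}
      else of_bool (\<phi> (fst \<tau>, i) = snd \<tau>))" for \<phi> :: "nat \<times> nat \<Rightarrow> nat"
  have split0: "(\<Sum>i=0..r. h i) = h 0 + (\<Sum>i=1..r. h i)" for h :: "nat \<Rightarrow> nat"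
    by (simp add: sum.atLeast_Suc_atMost)
  have inj: "inj_on \<Phi> D"
  proof (rule inj_onI)
    fix \<phi> \<psi> assume \<phi>: "\<phi> \<in> D" and \<psi>: "\<psi> \<in> D" and eq: "\<Phi> \<phi> = \<Phi> \<psi>"
    show "\<phi> = \<psi>"
    proof (rule PiE_ext[OF \<phi>[unfolded D_def] \<psi>[unfolded D_def]])
      fix x assume x: "x \<in> {..<e} \<times> {1..r}"
      obtain t i where [simp]: "x = (t, i)" by force
      have ti: "t < e" "1 \<le> i" "i \<le> r" using x by auto
      have j: "\<phi> (t, i) < j" using \<phi> x by (auto simp: D_def PiE_def Pi_def)
      have "\<Phi> \<phi> (t, \<phi> (t, i)) i = \<Phi> \<psi> (t, \<phi> (t, i)) i" using eq by simp
      hence "of_bool (\<psi> (t, i) = \<phi> (t, i)) = (1::nat)"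
        using ti j by (simp add: \<Phi>_def)
      hence "\<psi> (t, i) = \<phi> (t, i)" by (simp only: of_bool_eq_1_iff)
      thus "\<phi> x = \<psi> x" by simp
    qed
  qed
  have into: "\<Phi> ` D \<subseteq> digit_arrays e j r n p N"
  proof (clarify)
    fix \<phi> assume \<phi>: "\<phi> \<in> D"
    have le: "card {i\<in>{1..r}. \<phi> (t, i) = u} \<le> n" for t u
    proof -
      have "card {i\<in>{1..r}. \<phi> (t, i) = u} \<le> card {1..r}" by (rule card_mono) auto
      thus ?thesis using assms(2) by simp
    qed
    have row: "(\<Sum>i=1..r. of_bool (\<phi> (t, i) = u)) = card {i\<in>{1..r}. \<phi> (t, i) = u}" for t u
      by (simp add: of_bool_def sum.If_cases Int_def)
    have sz: "(\<Sum>i=0..r. \<Phi> \<phi> \<tau> i) = n" if "\<tau> \<in> {..<e} \<times> {..<j}" for \<tau>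
    proof -
      obtain t u where [simp]: "\<tau> = (t, u)" by force
      have "(\<Sum>i=0..r. \<Phi> \<phi> \<tau> i) = n - card {i\<in>{1..r}. \<phi> (t, i) = u} + (\<Sum>i=1..r. of_bool (\<phi> (t, i) = u))"
        using that unfolding split0 by (auto simp: \<Phi>_def intro!: sum.cong)
      thus ?thesis unfolding row using le[of t u] by simp
    qed
    have col: "(\<Sum>u<j. \<Phi> \<phi> (t, u) i) = 1" if "t < e" "i \<in> {1..r}" for t i
    proof -
      have "\<phi> (t, i) < j" using \<phi> that by (auto simp: D_def PiE_def Pi_def)
      moreover have "(\<Sum>u<j. \<Phi> \<phi> (t, u) i) = (\<Sum>u<j. of_bool (\<phi> (t, i) = u))"
        using that by (intro sum.cong) (auto simp: \<Phi>_def)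
      ultimately show ?thesis by (simp add: of_bool_def)
    qed
    have col0: "(\<Sum>u<j. \<Phi> \<phi> (t, u) 0) = p - 1" if "t < e" for t
    proof -
      have "n * j = (\<Sum>u<j. \<Sum>i=0..r. \<Phi> \<phi> (t, u) i)"
        using sz that by simp
      also have "\<dots> = (\<Sum>i=0..r. \<Sum>u<j. \<Phi> \<phi> (t, u) i)" by (rule sum.swap)
      also have "\<dots> = (\<Sum>u<j. \<Phi> \<phi> (t, u) 0) + r"
        unfolding split0 using col[OF that] by simp
      finally show ?thesis using assms(1) by simp
    qed
    have "\<Phi> \<phi> \<in> PiE ({..<e} \<times> {..<j}) (\<lambda>_. PiE {0..r} (\<lambda>_. {..N}))"
      using assms(3,4) by (auto simp: \<Phi>_def)
    thus "\<Phi> \<phi> \<in> digit_arrays e j r n p N"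
      using sz col col0 by (auto simp: digit_arrays_def)
  qed
  have onto: "digit_arrays e j r n p N \<subseteq> \<Phi> ` D"
  proof
    fix A assume A: "A \<in> digit_arrays e j r n p N"
    have "\<exists>w. \<forall>x\<in>{..<e} \<times> {1..r}. w x < j \<and> (\<forall>u<j. A (fst x, u) (snd x) = of_bool (w x = u))"
    proof (rule bchoice, rule ballI)
      fix x assume "x \<in> {..<e} \<times> {1..r}"
      hence "(\<Sum>u<j. A (fst x, u) (snd x)) = 1"
        using A by (auto simp: digit_arrays_def)
      from sum_eq_1_unique[OF this]
      show "\<exists>w. w < j \<and> (\<forall>u<j. A (fst x, u) (snd x) = of_bool (w = u))" by blast
    qed
    then obtain w where w: "\<And>t i. t < e \<Longrightarrow> i \<in> {1..r} \<Longrightarrow> w (t, i) < j"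
      "\<And>t i u. t < e \<Longrightarrow> i \<in> {1..r} \<Longrightarrow> u < j \<Longrightarrow> A (t, u) i = of_bool (w (t, i) = u)"
      by force
    define \<phi> where "\<phi> = restrict w ({..<e} \<times> {1..r})"
    have \<phi>D: "\<phi> \<in> D" 
      unfolding \<phi>_def D_def restrict_PiE_iff
    proof (rule ballI)
      fix x assume "x \<in> {..<e} \<times> {1..r}"
      hence "fst x < e" "snd x \<in> {1..r}" by (auto simp: mem_Times_iff)
      from w(1)[OF this] show "w x \<in> {..<j}" by simp
    qed
    have "\<Phi> \<phi> \<in> digit_arrays e j r n p N" using into \<phi>D by (rule subsetD[OF _ imageI])
    hence boxes: "A \<in> PiE ({..<e} \<times> {..<j}) (\<lambda>_. PiE {0..r} (\<lambda>_. {..N}))"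
      "\<Phi> \<phi> \<in> PiE ({..<e} \<times> {..<j}) (\<lambda>_. PiE {0..r} (\<lambda>_. {..N}))"
      using A unfolding digit_arrays_def by blast+
    have "A = \<Phi> \<phi>"
    proof (rule PiE_ext[OF boxes])
      fix \<tau> assume \<tau>: "\<tau> \<in> {..<e} \<times> {..<j}"
      obtain t u where tu [simp]: "\<tau> = (t, u)" by force
      have "A \<tau> i = \<Phi> \<phi> \<tau> i" if i: "i \<in> {0..r}" for i
      proof (cases "i = 0")
        case False
        hence "i \<in> {1..r}" using i by simp
        moreover have "t < e" "u < j" using \<tau> by auto
        ultimately show ?thesis using w(2)[of t i u] False by (simp add: \<Phi>_def \<phi>_def)
      next
        case True
        have "(\<Sum>i=0..r. A \<tau> i) = n"
          using A unfolding digit_arrays_def by (elim CollectE conjE bspec) (rule \<tau>)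
        hence "n = A \<tau> 0 + (\<Sum>i=1..r. A \<tau> i)" by (simp only: split0)
        also have "(\<Sum>i=1..r. A \<tau> i) = (\<Sum>i=1..r. of_bool (\<phi> (t, i) = u))"
          using \<tau> by (intro sum.cong refl) (simp add: \<phi>_def w(2))
        also have "\<dots> = card {i\<in>{1..r}. \<phi> (t, i) = u}"
          by (simp add: of_bool_def sum.If_cases Int_def)
        finally show ?thesis using True \<tau> by (auto simp: \<Phi>_def)
      qed
      thus "A \<tau> = \<Phi> \<phi> \<tau>"
        by (rule PiE_ext[OF PiE_mem[OF boxes(1) \<tau>] PiE_mem[OF boxes(2) \<tau>]])
    qed
    thus "A \<in> \<Phi> ` D" using \<phi>D by (rule image_eqI)
  qed
  from onto into have "digit_arrays e j r n p N = \<Phi> ` D" by (rule subset_antisym)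
  hence "card (digit_arrays e j r n p N) = card D"
    by (simp add: card_image[OF inj])
  also have "\<dots> = j ^ (e * r)" by (simp add: D_def card_PiE card_cartesian_product)
  finally show ?thesis .
qed

lemma geometric_sum_nat:
  fixes p :: nat
  assumes "0 < p"
  shows "(\<Sum>t<e. p ^ t) * (p - 1) = p ^ e - 1"
proof -
  obtain c where "p = Suc c" using assms by (cases p) auto
  hence "(\<Sum>t<e. p ^ t) * (p - 1) + 1 = p ^ e"
    by (induction e) (auto simp: algebra_simps)
  thus ?thesis by simp
qed

section \<open>Extraction of one coefficient by a power sum\<close>

text \<open>
  The heart of the argument. As a polynomial in the nodes \<open>v 1, ..., v r\<close> and the argument \<open>v 0\<close>, the
  divided difference \<open>\<psi>\<close> of \<open>F\<close> has degree \<open>n\<close>. With the weights, the summand has total degree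
  \<open>(r + 1) * (q - 1)\<close>, so only the monomial in which every variable has exponent \<open>q - 1\<close> survives
  the summation. This amounts to extracting from \<open>\<psi> ^ (j * E)\<close> the coefficient of
  \<open>v 0 ^ (q - 1) * (v 1 * ... * v r) ^ E\<close>. Since \<open>E\<close> has all base-\<open>p\<close> digits equal to \<open>1\<close>, the power is a
  product of Frobenius twists of \<open>\<psi> ^ j\<close>, and by uniqueness of digits the twist number \<open>t\<close> has to
  contribute exactly the \<open>p ^ t\<close>-th power of \<open>v 0 ^ (p - 1) * v 1 * ... * v r\<close>. In this degree all
  coefficients of \<open>\<psi>\<close> equal the leading coefficient of \<open>F\<close>, so it remains to count.
\<close>

lemma twisted_power_sum:
  fixes F :: "'a::{field,finite} poly"
  defines "p \<equiv> CHAR('a)" and "q \<equiv> CARD('a)"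
  assumes q: "q = p ^ e" and F: "degree F = n + r" and r: "r \<le> n" and n: "0 < n"
    and j: "n * j = r + (p - 1)"
  defines "E \<equiv> (\<Sum>t<e. p ^ t)"
  shows "\<exists>c. c \<noteq> 0 \<and> (\<Sum>v\<in>PiE {0..r} (\<lambda>_. UNIV). (\<Prod>i=1..r. v i ^ (q - 1 - E)) *
      poly (divided_diff F (image_mset v (mset_set {1..r}))) (v 0) ^ (j * E))
    = c * of_nat (j ^ (e * r))"
proof -
  define J where "J = {0..r}"
  define T where "T = {..<e} \<times> {..<j}"
  define N where "N = n + r"
  define Box where "Box = PiE J (\<lambda>_. {..N})"
  define \<mu> where "\<mu> i = (if i = 0 then p - 1 else 1)" for i :: nat
  define a where "a i = q - 1 - E * \<mu> i" for i
  define cf where "cf \<alpha> = coeff F (r + (\<Sum>i\<in>J. \<alpha> i))" for \<alpha> :: "nat \<Rightarrow> nat"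
  define \<psi> where "\<psi> v = poly (divided_diff F (image_mset v (mset_set {1..r}))) (v 0)" for v
  define C where "C A = (\<Prod>\<tau>\<in>T. cf (A \<tau>) ^ p ^ fst \<tau>)" for A :: "nat \<times> nat \<Rightarrow> nat \<Rightarrow> nat"
  define \<beta> where "\<beta> A i = (\<Sum>\<tau>\<in>T. p ^ fst \<tau> * A \<tau> i)" for A :: "nat \<times> nat \<Rightarrow> nat \<Rightarrow> nat" and i
  define G where "G = digit_arrays e j r n p N"
  define K where "K = (\<Prod>\<tau>\<in>T. lead_coeff F ^ p ^ fst \<tau>) * (-1) ^ card J"
  have p: "prime p" unfolding p_def by (rule prime_CHAR_finite_field)
  have p1: "p > 1" using p by (rule prime_gt_1_nat)
  have fin: "finite J" "finite T" "finite Box"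
    by (auto simp: J_def T_def Box_def intro!: finite_PiE)
  have E: "E * (p - 1) = q - 1"
    using geometric_sum_nat[of p e] p1 by (simp add: E_def q)
  have E\<mu>: "E * \<mu> i \<le> q - 1" for i
    unfolding E[symmetric] using p1 by (intro mult_le_mono2) (auto simp: \<mu>_def)
  have sum\<mu>: "(\<Sum>i\<in>J. \<mu> i) = n * j"
    unfolding J_def j by (subst sum.atLeast_Suc_atMost) (auto simp: \<mu>_def)
  have expand: "\<psi> v = (\<Sum>\<alpha>\<in>Box. cf \<alpha> * (\<Prod>i\<in>J. v i ^ \<alpha> i))" for v
  proof -
    have "insert 0 {1..r} = J" by (auto simp: J_def)
    thus ?thesis using poly_divided_diff[of "{1..r}" F N 0 v] F
      by (simp add: \<psi>_def Box_def cf_def N_def)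
  qed
  have frob: "\<psi> v ^ p ^ t = (\<Sum>\<alpha>\<in>Box. cf \<alpha> ^ p ^ t * (\<Prod>i\<in>J. v i ^ (p ^ t * \<alpha> i)))" for v t
  proof -
    have "\<psi> v ^ p ^ t = (\<Sum>\<alpha>\<in>Box. (cf \<alpha> * (\<Prod>i\<in>J. v i ^ \<alpha> i)) ^ p ^ t)"
      unfolding expand using p by (intro freshmans_dream_sum'[of _ t]) (auto simp: p_def)
    thus ?thesis
      by (simp add: power_mult_distrib prod_power_distrib power_mult[symmetric] mult.commute)
  qed
  have pow: "\<psi> v ^ (j * E) = (\<Sum>A\<in>PiE T (\<lambda>_. Box). C A * (\<Prod>i\<in>J. v i ^ \<beta> A i))" for v
  proof -
    have "\<psi> v ^ (j * E) = (\<Prod>t<e. \<Prod>u<j. \<psi> v ^ p ^ t)"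
      by (simp add: E_def power_sum power_mult[symmetric] sum_distrib_left mult.commute)
    also have "\<dots> = (\<Prod>\<tau>\<in>T. \<psi> v ^ p ^ fst \<tau>)"
      unfolding T_def prod.cartesian_product by (simp add: case_prod_unfold)
    also have "\<dots> = (\<Sum>A\<in>PiE T (\<lambda>_. Box). \<Prod>\<tau>\<in>T. cf (A \<tau>) ^ p ^ fst \<tau> * (\<Prod>i\<in>J. v i ^ (p ^ fst \<tau> * A \<tau> i)))"
      unfolding frob using fin by (intro prod_sum_PiE) auto
    also have "\<dots> = (\<Sum>A\<in>PiE T (\<lambda>_. Box). C A * (\<Prod>i\<in>J. v i ^ \<beta> A i))"
    proof (rule sum.cong[OF refl])
      fix A
      have "(\<Prod>\<tau>\<in>T. \<Prod>i\<in>J. v i ^ (p ^ fst \<tau> * A \<tau> i)) = (\<Prod>i\<in>J. v i ^ \<beta> A i)"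
        by (subst prod.swap) (simp add: \<beta>_def power_sum)
      thus "(\<Prod>\<tau>\<in>T. cf (A \<tau>) ^ p ^ fst \<tau> * (\<Prod>i\<in>J. v i ^ (p ^ fst \<tau> * A \<tau> i)))
          = C A * (\<Prod>i\<in>J. v i ^ \<beta> A i)"
        by (simp add: prod.distrib C_def)
    qed
    finally show ?thesis .
  qed
  have weight: "(\<Prod>i=1..r. v i ^ (q - 1 - E)) = (\<Prod>i\<in>J. v i ^ a i)" for v :: "nat \<Rightarrow> 'a"
  proof -
    have "(\<Prod>i\<in>J. v i ^ a i) = v 0 ^ a 0 * (\<Prod>i=1..r. v i ^ a i)"
      unfolding J_def by (simp add: prod.atLeast_Suc_atMost)
    also have "\<dots> = (\<Prod>i=1..r. v i ^ (q - 1 - E))"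
      using E by (auto simp: a_def \<mu>_def intro!: prod.cong)
    finally show ?thesis ..
  qed
  have "(\<Sum>v\<in>PiE J (\<lambda>_. UNIV). (\<Prod>i=1..r. v i ^ (q - 1 - E)) * \<psi> v ^ (j * E))
      = (\<Sum>v\<in>PiE J (\<lambda>_. UNIV). \<Sum>A\<in>PiE T (\<lambda>_. Box). C A * (\<Prod>i\<in>J. v i ^ (a i + \<beta> A i)))"
    unfolding weight pow sum_distrib_left
    by (intro sum.cong refl) (simp add: power_add prod.distrib mult_ac)
  also have "\<dots> = (\<Sum>A\<in>PiE T (\<lambda>_. Box). \<Sum>v\<in>PiE J (\<lambda>_. UNIV). C A * (\<Prod>i\<in>J. v i ^ (a i + \<beta> A i)))"
    by (rule sum.swap)
  also have "\<dots> = (\<Sum>A\<in>PiE T (\<lambda>_. Box). C A * (\<Prod>i\<in>J. \<Sum>x\<in>UNIV. x ^ (a i + \<beta> A i)))"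
    using fin by (intro sum.cong refl) (simp add: sum_distrib_left prod_sum_PiE)
  also have "\<dots> = (\<Sum>A\<in>G. C A * (\<Prod>i\<in>J. \<Sum>x\<in>UNIV. x ^ (a i + \<beta> A i)))"
  proof (rule sum.mono_neutral_right)
    show "finite (PiE T (\<lambda>_. Box))" using fin by (auto intro: finite_PiE)
    show "G \<subseteq> PiE T (\<lambda>_. Box)" by (auto simp: G_def digit_arrays_def T_def Box_def J_def)
    (* A nonzero contribution needs every exponent to be a positive multiple of q - 1; the
       total degree then makes all of them equal to q - 1, which is the situation of digits_unique. *)
    show "\<forall>A\<in>PiE T (\<lambda>_. Box) - G. C A * (\<Prod>i\<in>J. \<Sum>x\<in>UNIV. x ^ (a i + \<beta> A i)) = 0"
    proof (rule ballI, rule ccontr)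
      fix A assume A: "A \<in> PiE T (\<lambda>_. Box) - G"
        and nz: "C A * (\<Prod>i\<in>J. \<Sum>x\<in>UNIV. x ^ (a i + \<beta> A i)) \<noteq> 0"
      have size: "(\<Sum>i\<in>J. A \<tau> i) \<le> n" if "\<tau> \<in> T" for \<tau>
      proof -
        have "cf (A \<tau>) \<noteq> 0" using nz fin that p1 by (auto simp: C_def)
        thus ?thesis using le_degree[of F] F unfolding cf_def by fastforce
      qed
      have ge: "q - 1 \<le> a i + \<beta> A i" if "i \<in> J" for i
      proof -
        have "(\<Sum>x\<in>(UNIV::'a set). x ^ (a i + \<beta> A i)) \<noteq> 0" using nz fin that by auto
        hence "0 < a i + \<beta> A i \<and> (q - 1) dvd (a i + \<beta> A i)"
          unfolding sum_power_finite_field q_def by (simp split: if_splits)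
        thus ?thesis by (auto dest: dvd_imp_le)
      qed
      have ge': "E * \<mu> i \<le> \<beta> A i" if "i \<in> J" for i
        using ge[OF that] E\<mu>[of i] by (simp add: a_def)
      have "(\<Sum>i\<in>J. \<beta> A i) = (\<Sum>\<tau>\<in>T. p ^ fst \<tau> * (\<Sum>i\<in>J. A \<tau> i))"
        unfolding \<beta>_def sum_distrib_left by (rule sum.swap)
      also have "\<dots> \<le> (\<Sum>\<tau>\<in>T. p ^ fst \<tau> * n)"
        using size by (intro sum_mono mult_le_mono2) auto
      also have "\<dots> = (\<Sum>t<e. \<Sum>u<j. p ^ t * n)"
        unfolding T_def sum.cartesian_product by (simp add: case_prod_unfold)
      also have "\<dots> = (\<Sum>i\<in>J. E * \<mu> i)"
      proof -
        have "(\<Sum>i\<in>J. E * \<mu> i) = E * (n * j)"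
          by (simp only: sum_distrib_left[symmetric] sum\<mu>)
        moreover have "(\<Sum>t<e. \<Sum>u<j. p ^ t * n) = (\<Sum>t<e. p ^ t * (n * j))"
          by (intro sum.cong refl) (simp add: mult_ac)
        ultimately show ?thesis by (simp only: E_def sum_distrib_right)
      qed
      finally have "(\<Sum>i\<in>J. \<beta> A i) \<le> (\<Sum>i\<in>J. E * \<mu> i)" .
      moreover have "(\<Sum>i\<in>J. E * \<mu> i) \<le> (\<Sum>i\<in>J. \<beta> A i)" using ge' by (rule sum_mono)
      ultimately have "(\<Sum>i\<in>J. E * \<mu> i) = (\<Sum>i\<in>J. \<beta> A i)" by simp
      hence eq: "E * \<mu> i = \<beta> A i" if "i \<in> J" for i
        using sum_mono_inv[of "\<lambda>i. E * \<mu> i" J "\<beta> A" i] ge' fin that by auto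
      have rows: "(\<Sum>i\<in>J. \<Sum>u<j. A (t, u) i) \<le> n * j" if "t < e" for t
      proof -
        have "(\<Sum>i\<in>J. \<Sum>u<j. A (t, u) i) = (\<Sum>u<j. \<Sum>i\<in>J. A (t, u) i)" by (rule sum.swap)
        also have "\<dots> \<le> (\<Sum>u<j. n)" using size that by (intro sum_mono) (auto simp: T_def)
        finally show ?thesis by (simp add: mult.commute)
      qed
      have digit: "(\<Sum>u<j. A (t, u) i) = \<mu> i" if "t < e" "i \<in> J" for t i
      proof (rule digits_unique[where B = "\<lambda>t i. \<Sum>u<j. A (t, u) i" and J = J and p = p and e = e])
        show "\<mu> i < p" for i using p1 by (auto simp: \<mu>_def)
        show "(\<Sum>t<e. p ^ t * (\<Sum>u<j. A (t, u) i)) = (\<Sum>t<e. p ^ t * \<mu> i)" if "i \<in> J" for i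
        proof -
          have "(\<Sum>t<e. p ^ t * (\<Sum>u<j. A (t, u) i)) = \<beta> A i"
            unfolding \<beta>_def T_def sum_distrib_left sum.cartesian_product by (simp add: case_prod_unfold)
          also have "\<dots> = (\<Sum>t<e. p ^ t * \<mu> i)"
            using eq[OF that] by (simp add: E_def sum_distrib_right)
          finally show ?thesis .
        qed
      qed (use that fin rows sum\<mu> in auto)
      have "(\<Sum>i\<in>J. A (t, u) i) = n" if "t < e" "u < j" for t u
      proof -
        have "(\<Sum>u<j. \<Sum>i\<in>J. A (t, u) i) = (\<Sum>i\<in>J. \<Sum>u<j. A (t, u) i)" by (rule sum.swap)
        also have "\<dots> = (\<Sum>u<j. n)" using digit that sum\<mu> by (simp add: mult.commute)
        finally show ?thesis
          using sum_mono_inv[of "\<lambda>u. \<Sum>i\<in>J. A (t, u) i" "{..<j}" "\<lambda>_. n" u] size that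
          by (auto simp: T_def)
      qed
      hence "A \<in> G" using A digit
        by (auto simp: G_def digit_arrays_def T_def Box_def J_def \<mu>_def)
      thus False using A by simp
    qed
  qed
  also have "\<dots> = (\<Sum>A\<in>G. K)"
  proof (rule sum.cong[OF refl])
    fix A assume A: "A \<in> G"
    have "C A = (\<Prod>\<tau>\<in>T. lead_coeff F ^ p ^ fst \<tau>)"
      unfolding C_def
    proof (rule prod.cong[OF refl])
      fix \<tau> assume "\<tau> \<in> T"
      hence "(\<Sum>i\<in>J. A \<tau> i) = n" using A by (auto simp: G_def digit_arrays_def T_def J_def)
      thus "cf (A \<tau>) ^ p ^ fst \<tau> = lead_coeff F ^ p ^ fst \<tau>" by (simp add: cf_def F add.commute)
    qed
    moreover have "(\<Sum>x\<in>(UNIV::'a set). x ^ (a i + \<beta> A i)) = -1" if "i \<in> J" for i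
    proof -
      have "\<beta> A i = (\<Sum>t<e. p ^ t * (\<Sum>u<j. A (t, u) i))"
        unfolding \<beta>_def T_def sum_distrib_left sum.cartesian_product by (simp add: case_prod_unfold)
      also have "\<dots> = (\<Sum>t<e. p ^ t * \<mu> i)"
        using A that by (intro sum.cong refl) (auto simp: G_def digit_arrays_def J_def \<mu>_def)
      also have "\<dots> = E * \<mu> i" by (simp add: E_def sum_distrib_right)
      finally have "a i + \<beta> A i = q - 1" using E\<mu>[of i] by (simp add: a_def)
      moreover have "q - 1 > 0" using card_mono[of UNIV "{0, 1::'a}"] by (simp add: q_def)
      ultimately show ?thesis by (simp add: sum_power_finite_field q_def)
    qed
    ultimately show "C A * (\<Prod>i\<in>J. \<Sum>x\<in>UNIV. x ^ (a i + \<beta> A i)) = K"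
      by (simp add: K_def)
  qed
  also have "\<dots> = K * of_nat (j ^ (e * r))"
    using card_digit_arrays[OF j r, of N e] n by (simp add: G_def N_def mult.commute)
  finally have main: "(\<Sum>v\<in>PiE {0..r} (\<lambda>_. UNIV). (\<Prod>i=1..r. v i ^ (q - 1 - E)) *
      poly (divided_diff F (image_mset v (mset_set {1..r}))) (v 0) ^ (j * E))
    = K * of_nat (j ^ (e * r))" by (simp add: J_def \<psi>_def)
  have "K \<noteq> 0"
  proof -
    have "F \<noteq> 0" using F n by auto
    hence "lead_coeff F \<noteq> 0" by simp
    thus ?thesis using fin by (auto simp: K_def simp del: leading_coeff_0_iff)
  qed
  show ?thesis by (rule exI[of _ K], rule conjI, fact \<open>K \<noteq> 0\<close>, rule main)
qed

section \<open>Divided differences cannot all be permutations\<close>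

text \<open>
  If all these polynomials were permutations, the sum over \<open>x\<close> of any fixed power of \<open>f[S, x]\<close> would not
  depend on \<open>S\<close>. Multiplying by weights in the free nodes and summing over them therefore gives
  \<open>0\<close>, provided there are free nodes, whereas \<open>twisted_power_sum\<close> evaluates the same sum to a
  nonzero constant times a power of \<open>j\<close>, with \<open>0 < j < p\<close>. Of the \<open>m\<close> nodes, \<open>r\<close> are free and the others
  are put at \<open>0\<close>.
\<close>

lemma ex_divided_diff_not_inj:
  fixes f :: "'a::{field,finite} poly"
  assumes f: "degree f = m + n" and n: "2 \<le> n" "n \<le> m + 1"
  shows "\<exists>S. size S = m \<and> \<not> inj (poly (divided_diff f S))"
proof (rule ccontr)
  assume "\<not> ?thesis"
  hence perm: "inj (poly (divided_diff f S))" if "size S = m" for S using that by blast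
  define p where "p = CHAR('a)"
  have p: "prime p" unfolding p_def by (rule prime_CHAR_finite_field)
  have p1: "p \<ge> 2" using p by (rule prime_ge_2_nat)
  obtain e where e: "CARD('a) = p ^ e"
    using card_finite_field_prime_power[where 'a='a] by (auto simp: p_def)
  (* j is (p - 1) / n rounded up, so that r < n, there are enough nodes for r free ones, and
     j is not divisible by p. *)
  define j where "j = (p - 1 + (n - 1)) div n"
  define r where "r = n * j - (p - 1)"
  define E where "E = (\<Sum>t<e. p ^ t)"
  have "n * j \<le> p - 1 + (n - 1)" "p - 1 \<le> n * j"
  proof -
    have "n * j + (p - 1 + (n - 1)) mod n = p - 1 + (n - 1)" unfolding j_def by simp
    moreover have "(p - 1 + (n - 1)) mod n < n" using n by simp
    ultimately show "n * j \<le> p - 1 + (n - 1)" "p - 1 \<le> n * j" by linarith+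
  qed
  hence nj: "n * j = r + (p - 1)" and rn: "r \<le> n - 1" by (auto simp: r_def)
  have j0: "0 < j" using nj p1 by (cases j) auto
  have jp: "j < p"
  proof (rule ccontr)
    assume "\<not> j < p"
    hence "n * p \<le> n * j" by simp
    moreover have "2 * (p - 1) + n \<le> n * (p - 1) + n" using n by simp
    moreover have "n * (p - 1) + n = n * p" using p1 by (cases p) auto
    ultimately show False using nj rn p1 n by linarith
  qed
  have q2: "CARD('a) \<ge> 2" using card_mono[of UNIV "{0, 1::'a}"] by simp
  have E: "E * (p - 1) = CARD('a) - 1"
    using geometric_sum_nat[of p e] p1 e by (simp add: E_def)
  have E0: "E > 0" using E q2 by (cases E) auto
  define F where "F = divided_diff f (replicate_mset (m - r) 0)"
  have degF: "degree F = n + r" using f rn n by (simp add: F_def degree_divided_diff)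
  have "\<exists>c. c \<noteq> 0 \<and> (\<Sum>v\<in>PiE {0..r} (\<lambda>_. UNIV). (\<Prod>i=1..r. v i ^ (CARD('a) - 1 - E)) *
      poly (divided_diff F (image_mset v (mset_set {1..r}))) (v 0) ^ (j * E))
    = c * of_nat (j ^ (e * r))"
    unfolding E_def p_def by (rule twisted_power_sum) (use e degF rn nj n in \<open>auto simp: p_def\<close>)
  then obtain c where c: "c \<noteq> 0" and sum: "(\<Sum>v\<in>PiE {0..r} (\<lambda>_. UNIV). (\<Prod>i=1..r. v i ^ (CARD('a) - 1 - E)) *
      poly (divided_diff F (image_mset v (mset_set {1..r}))) (v 0) ^ (j * E))
    = c * of_nat (j ^ (e * r))" by blast
  have inner: "(\<Sum>x\<in>UNIV. poly (divided_diff F (image_mset v (mset_set {1..r}))) x ^ (j * E))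
      = (\<Sum>x\<in>(UNIV::'a set). x ^ (j * E))" for v
  proof -
    have "divided_diff F (image_mset v (mset_set {1..r}))
        = divided_diff f (replicate_mset (m - r) 0 + image_mset v (mset_set {1..r}))"
      by (simp add: F_def divided_diff_union)
    hence inj: "inj (poly (divided_diff F (image_mset v (mset_set {1..r}))))"
      using perm rn n by simp
    hence "bij (poly (divided_diff F (image_mset v (mset_set {1..r}))))"
      by (simp add: bij_def finite_UNIV_inj_surj)
    from sum.reindex_bij_betw[OF this, of "\<lambda>x. x ^ (j * E)"] show ?thesis .
  qed
  have "(\<Sum>v\<in>PiE {0..r} (\<lambda>_. UNIV). (\<Prod>i=1..r. v i ^ (CARD('a) - 1 - E)) *
      poly (divided_diff F (image_mset v (mset_set {1..r}))) (v 0) ^ (j * E))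
    = (\<Sum>x\<in>UNIV. \<Sum>v\<in>PiE {1..r} (\<lambda>_. UNIV). (\<Prod>i=1..r. v i ^ (CARD('a) - 1 - E)) *
      poly (divided_diff F (image_mset v (mset_set {1..r}))) x ^ (j * E))"
  proof -
    have ins: "{0..r} = insert 0 {1..r}" by auto
    have "image_mset (v(0 := x)) (mset_set {1..r}) = image_mset v (mset_set {1..r})"
      "(\<Prod>i=1..r. (v(0 := x)) i ^ (CARD('a) - 1 - E)) = (\<Prod>i=1..r. v i ^ (CARD('a) - 1 - E))"
      for v and x :: 'a
      by (auto intro!: image_mset_cong prod.cong)
    thus ?thesis unfolding ins by (subst sum_PiE_insert) simp_all
  qed
  also have "\<dots> = (\<Sum>v\<in>PiE {1..r} (\<lambda>_. UNIV). (\<Prod>i=1..r. v i ^ (CARD('a) - 1 - E)) *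
      (\<Sum>x\<in>(UNIV::'a set). x ^ (j * E)))"
    by (subst sum.swap) (simp only: sum_distrib_left[symmetric] inner)
  also have "\<dots> = (\<Prod>i=1..r. \<Sum>y\<in>(UNIV::'a set). y ^ (CARD('a) - 1 - E)) * (\<Sum>x\<in>UNIV. x ^ (j * E))"
    by (subst prod_sum_PiE) (auto simp: sum_distrib_right)
  also have "\<dots> = 0"
  (* For positive r the weights sum to 0. Without free nodes the power sum over x has to
     vanish itself, which is where j < p - 1, hence n > 1, enters. *)
  proof (cases "r = 0")
    case True
    have "2 * j \<le> n * j" using n by simp
    hence "j < p - 1" using nj True j0 by linarith
    hence "j * E < CARD('a) - 1" unfolding E[symmetric] using E0 by simp
    thus ?thesis by (auto simp: sum_power_finite_field dest: dvd_imp_le)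
  next
    case False
    have "(\<Sum>y\<in>(UNIV::'a set). y ^ (CARD('a) - 1 - E)) = 0"
      using E0 q2 by (auto simp: sum_power_finite_field dest: dvd_imp_le)
    thus ?thesis using False by auto
  qed
  finally have "of_nat (j ^ (e * r)) = (0::'a)" using sum c by simp
  hence "p dvd j ^ (e * r)" unfolding p_def of_nat_eq_0_iff_char_dvd .
  hence "p dvd j" using p prime_dvd_power by blast
  thus False using j0 jp by (auto dest: dvd_imp_le)
qed

section \<open>Deep holes\<close>

lemma hamming_dist_generated_word:
  assumes "distinct xs"
  shows "hamming_dist (generated_word xs f) (generated_word xs g)
    = card {x \<in> set xs. poly f x \<noteq> poly g x}"
proof -
  have "{x \<in> set xs. poly f x \<noteq> poly g x}
      = (!) xs ` {i. i < length xs \<and> poly f (xs ! i) \<noteq> poly g (xs ! i)}"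
    by (auto simp: in_set_conv_nth)
  moreover have "inj_on ((!) xs) {i. i < length xs \<and> poly f (xs ! i) \<noteq> poly g (xs ! i)}"
    using assms by (auto simp: inj_on_def nth_eq_iff_index_eq)
  ultimately have "card {x \<in> set xs. poly f x \<noteq> poly g x}
      = card {i. i < length xs \<and> poly f (xs ! i) \<noteq> poly g (xs ! i)}"
    by (simp add: card_image)
  moreover have "{i. i < length xs \<and> poly f (xs ! i) \<noteq> poly g (xs ! i)}
      = {i. i < length (generated_word xs f) \<and> generated_word xs f ! i \<noteq> generated_word xs g ! i}"
    by (auto simp: generated_word_def)
  ultimately show ?thesis by (simp add: hamming_dist_def)
qed

lemma card_disagree:
  assumes "finite X"
  shows "card {x \<in> X. P x \<noteq> Q x} = card X - card {x \<in> X. P x = Q x}"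
proof -
  have "{x \<in> X. P x \<noteq> Q x} = X - {x \<in> X. P x = Q x}" by blast
  thus ?thesis using assms by (simp add: card_Diff_subset)
qed

text \<open>
  The word generated by \<open>T ^ k\<close> agrees with a codeword in at most \<open>k\<close> places.
\<close>

lemma covering_radius_ge:
  fixes xs :: "'a::{field,finite} list"
  assumes "distinct xs"
  shows "length xs - k \<le> covering_radius (length xs) (reed_solomon_code xs k)"
proof -
  let ?C = "reed_solomon_code xs k" and ?w = "generated_word xs (monom 1 k)"
  have "length xs - k \<le> hamming_dist ?w (generated_word xs g)" if g: "g = 0 \<or> degree g < k" for g
  proof -
    have "coeff (monom 1 k - g) k = 1" using g by (auto simp: coeff_eq_0)
    hence nz: "monom 1 k - g \<noteq> 0" by (metis coeff_0 zero_neq_one)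
    have "degree (monom 1 k - g) \<le> k"
      using g by (intro degree_diff_le) (auto simp: degree_monom_le)
    hence roots: "card {x. poly (monom 1 k - g) x = 0} \<le> k"
      using card_poly_roots_bound[OF nz] by simp
    have "card {x \<in> set xs. poly (monom 1 k) x = poly g x} \<le> card {x. poly (monom 1 k - g) x = 0}"
      by (intro card_mono) auto
    with roots show ?thesis using assms
      by (simp add: hamming_dist_generated_word card_disagree distinct_card)
  qed
  hence "length xs - k \<le> dist_to_code ?w ?C"
    unfolding dist_to_code_def
    using finite_imageI[OF finite_reed_solomon_code[of xs k]]
    by (subst Min_ge_iff) (auto simp: reed_solomon_code_nonempty reed_solomon_code_def)
  also have "\<dots> \<le> covering_radius (length xs) ?C"
    unfolding covering_radius_def
    using finite_imageI[OF finite_words[of "length xs"]]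
    by (intro Max_ge) (auto simp: words_def generated_word_def)
  finally show ?thesis .
qed

lemma deep_hole_agreement_le:
  fixes xs :: "'a::{field,finite} list"
  assumes "distinct xs"
    and "deep_hole (length xs) (reed_solomon_code xs k) (generated_word xs f)"
    and "degree g < k"
  shows "card {x \<in> set xs. poly f x = poly g x} \<le> k \<or> length xs \<le> k"
proof -
  have "length xs - k \<le> dist_to_code (generated_word xs f) (reed_solomon_code xs k)"
    using assms(2) covering_radius_ge[OF assms(1)] by (simp add: deep_hole_def)
  also have "\<dots> \<le> hamming_dist (generated_word xs f) (generated_word xs g)"
    unfolding dist_to_code_def using assms(3) finite_imageI[OF finite_reed_solomon_code[of xs k]]
    by (intro Min_le) (auto simp: reed_solomon_code_def)
  also have "\<dots> = length xs - card {x \<in> set xs. poly f x = poly g x}"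
    using assms(1) by (simp add: hamming_dist_generated_word card_disagree distinct_card)
  finally have "length xs - k \<le> length xs - card {x \<in> set xs. poly f x = poly g x}" .
  moreover have "card {x \<in> set xs. poly f x = poly g x} \<le> length xs"
    using assms(1) card_mono[of "set xs" "{x \<in> set xs. poly f x = poly g x}"]
    by (auto simp: distinct_card)
  ultimately show ?thesis by linarith
qed

text \<open>
  A collision of \<open>f[A, _]\<close> at \<open>x\<close> and \<open>y\<close> with common value \<open>c\<close> says that \<open>f\<close> minus its remainder modulo
  \<open>W\<close>, the monic polynomial with root set \<open>A\<close>, agrees with \<open>c * W\<close> also at \<open>x\<close> and \<open>y\<close>. So \<open>c * W\<close> plus the
  remainder is a codeword polynomial that meets \<open>f\<close> in \<open>k + 1\<close> evaluation points.
\<close>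

lemma deep_hole_divided_diff_inj_on:
  fixes xs :: "'a::{field,finite} list"
  assumes xs: "enumerates_nonzero xs" and k: "k < length xs"
    and deep: "deep_hole (length xs) (reed_solomon_code xs k) (generated_word xs f)"
    and A: "0 \<notin> A" "card A + 1 = k"
  shows "inj_on (poly (divided_diff f (mset_set A))) (- insert 0 A)"
proof (rule inj_onI, rule ccontr)
  fix x y assume xy: "x \<in> - insert 0 A" "y \<in> - insert 0 A" "x \<noteq> y"
    and eq: "poly (divided_diff f (mset_set A)) x = poly (divided_diff f (mset_set A)) y"
  let ?Q = "divided_diff f (mset_set A)" and ?W = "\<Prod>a\<in>A. [:-a, 1:]"
  let ?c = "poly ?Q x"
  define g where "g = smult ?c ?W + f mod ?W"
  have degW: "degree ?W = card A" by (simp add: degree_prod_eq_sum_degree)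
  have "?W \<noteq> 0" by simp
  hence "degree (f mod ?W) \<le> card A"
    using degree_mod_less[of ?W f] degW by auto
  hence "degree g \<le> card A"
    unfolding g_def using degW by (intro degree_add_le) auto
  hence g: "degree g < k" using A by simp
  have "f = ?Q * ?W + f mod ?W"
    by (simp add: divided_diff_def prod_unfold_prod_mset)
  hence diff: "f - g = ?W * (?Q - [:?c:])"
    by (simp add: g_def algebra_simps)
  have "poly f z = poly g z" if "z \<in> insert x (insert y A)" for z
  proof -
    have "poly (f - g) z = 0" unfolding diff using that eq by (auto simp: poly_prod)
    thus ?thesis by simp
  qed
  hence "card (insert x (insert y A)) \<le> card {z \<in> set xs. poly f z = poly g z}"
    using xs A(1) xy by (intro card_mono) (auto simp: enumerates_nonzero_def)
  moreover have "card (insert x (insert y A)) = k + 1" using xy A by simp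
  ultimately show False
    using deep_hole_agreement_le[OF _ deep g] xs k by (simp add: enumerates_nonzero_def)
qed

theorem theorem5p5:
  fixes xs :: "'a::{field,finite} list"
    and f :: "'a poly"
    and q k d :: nat
    and \<epsilon> :: real
  assumes "q = CARD('a)"
    and "enumerates_nonzero xs"
    and "k > d" and "d \<ge> 3" and "q - 1 > k + d"
    and "0 < \<epsilon>" and "\<epsilon> < 1"
    and "degree f = k + d"
    and "real q > max ((real k + 1)\<^sup>2) (14 * real d powr (2 + \<epsilon>))"
    and "real k \<ge> real d * (2 / \<epsilon> + 1)"
  shows "\<not> deep_hole (q - 1) (reed_solomon_code xs k) (generated_word xs f)"
proof
  assume deep: "deep_hole (q - 1) (reed_solomon_code xs k) (generated_word xs f)"
  have len: "length xs = q - 1" using length_enumerates_nonzero[OF assms(2)] assms(1) by simp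
  define m where "m = k - 1"
  have k: "k = m + 1" using assms(3) by (simp add: m_def)
  have deg: "degree f = m + (d + 1)" using assms(8) k by simp
  have kd: "3 * d < k"
  proof -
    have "2 < 2 / \<epsilon>" using assms(6,7) by (simp add: field_simps)
    hence "real d * 3 < real d * (2 / \<epsilon> + 1)" using assms(4) by simp
    thus ?thesis using assms(10) by linarith
  qed
  have "real ((k + 1)\<^sup>2) < real q" using assms(9) by (simp add: add.commute)
  hence q: "(k + 1)\<^sup>2 < q" by (simp only: of_nat_less_iff)
  have "3 * ((2 * m + 1) * (d + 1)) \<le> (2 * m + 1) * (m + 3)"
  proof -
    have "3 * (d + 1) \<le> m + 3" using kd k by simp
    from mult_le_mono2[OF this, of "2 * m + 1"] show ?thesis by (simp add: algebra_simps)
  qed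
  also have "\<dots> < 3 * ((m + 2)\<^sup>2 - 1)"
    by (simp add: power2_eq_square algebra_simps)
  finally have "(2 * m + 1) * (d + 1) < (m + 2)\<^sup>2 - 1" by simp
  hence bound: "(2 * m + 1) * (d + 1) < CARD('a) - 1" using q k assms(1) by simp
  have inj: "inj (poly (divided_diff f S))" if "size S = m" for S
  proof (rule inj_divided_diff_all_multisets[OF _ _ _ that])
    show "inj_on (poly (divided_diff f (mset_set A))) (- insert 0 A)"
      if "0 \<notin> A" "card A = m" for A
      using deep_hole_divided_diff_inj_on[OF assms(2) _ _ that(1), of k f] deep len assms(5) that k
      by simp
  qed (use deg bound in auto)
  obtain S where "size S = m" "\<not> inj (poly (divided_diff f S))"
    using ex_divided_diff_not_inj[OF deg] assms(3,4) k by auto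
  thus False using inj by blast
qed

end
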